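(* For all $d\in\mathbb{N}$ and $\mathbf{s}\in(\mathbb{Z}\setminus\{0\})^d$, $$M_{\mathcal A}(\overleftarrow{\mathbf{s}})=(-1)^{|\mathbf{s}|}M_{\mathcal A}(-\mathbf{s}).$$ In particular, for all $\mathbf{s}\in\mathbb{N}^d$, $$t_{\mathcal A}(\overleftarrow{\mathbf{s}})=(-1)^{|\mathbf{s}|}\zeta^{(2)}_{\mathcal A}(\mathbf{s});$$ if $d$ is even, then $$T_{\mathcal A}(\overleftarrow{\mathbf{s}})=(-1)^{|\mathbf{s}|}T_{\mathcal A}(\mathbf{s})\quad\text{and}\quad S_{\mathcal A}(\overleftarrow{\mathbf{s}})=(-1)^{|\mathbf{s}|}S_{\mathcal A}(\mathbf{s});$$ and if $d$ is odd, then $$T_{\mathcal A}(\overleftarrow{\mathbf{s}})=(-1)^{|\mathbf{s}|}S_{\mathcal A}(\mathbf{s})\quad\text{and}\quad S_{\mathcal A}(\overleftarrow{\mathbf{s}})=(-1)^{|\mathbf{s}|}T_{\mathcal A}(\mathbf{s}).$$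
   Context: Let $\mathcal{P}$ be the set of primes and $\mathcal{A}=\prod_{p\in\mathcal P}(\mathbb{Z}/p\mathbb{Z})\big/\bigoplus_{p\in\mathcal P}(\mathbb{Z}/p\mathbb{Z})$; two families of residues are equal in $\mathcal A$ iff they agree for all but finitely many $p$. $\mathbb{N}$ is the set of positive integers. For $\mathbf{s}=(s_1,\dots,s_d)\in(\mathbb{Z}\setminus\{0\})^d$ put $|\mathbf{s}|=|s_1|+\cdots+|s_d|$, $-\mathbf{s}=(-s_1,\dots,-s_d)$, $\overleftarrow{\mathbf{s}}=(s_d,\dots,s_1)$. The finite multiple mixed value is $$M_{\mathcal A}(\mathbf{s})=\Bigg(\sum_{\substack{p>n_1>\cdots>n_d>0\\ n_j\text{ even if }s_j>0,\ n_j\text{ odd if }s_j<0}}\ \prod_{j=1}^d\frac1{n_j^{|s_j|}}\bmod p\Bigg)_{p\in\mathcal P}\in\mathcal A.$$ For $\mathbf{s}\in\mathbb{N}^d$: $t_{\mathcal A}(\mathbf{s})=M_{\mathcal A}(-s_1,\dots,-s_d)$ (all $n_j$ odd); $\zeta^{(2)}_{\mathcal A}(\mathbf{s})=M_{\mathcal A}(s_1,\dots,s_d)$ (all $n_j$ even); $T_{\mathcal A}(\mathbf{s})=M_{\mathcal A}\big((-1)^{d}s_1,\dots,(-1)^{d-j+1}s_j,\dots,-s_d\big)$ (i.e. $n_j\equiv d-j+1 \pmod 2$); $S_{\mathcal A}(\mathbf{s})=M_{\mathcal A}\big((-1)^{d-1}s_1,\dots,(-1)^{d-j}s_j,\dots,s_d\big)$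 (i.e. $n_j\equiv d-j\pmod 2$). *)

theory Defs
  imports "HOL-Number_Theory.Residues" "HOL-Algebra.QuotRing"
begin

section \<open>Direct products and direct sums of families of rings\<close>

definition product_ring :: "'i set \<Rightarrow> ('i \<Rightarrow> ('a, 'm) ring_scheme) \<Rightarrow> ('i \<Rightarrow> 'a) ring" where
  "product_ring I R =
    \<lparr>carrier = (\<Pi>\<^sub>E i\<in>I. carrier (R i)),
     monoid.mult = (\<lambda>x y. \<lambda>i\<in>I. x i \<otimes>\<^bsub>R i\<^esub> y i),
     one = (\<lambda>i\<in>I. \<one>\<^bsub>R i\<^esub>),
     zero = (\<lambda>i\<in>I. \<zero>\<^bsub>R i\<^esub>),
     add = (\<lambda>x y. \<lambda>i\<in>I. x i \<oplus>\<^bsub>R i\<^esub> y i)\<rparr>"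

definition direct_sum_ideal :: "'i set \<Rightarrow> ('i \<Rightarrow> ('a, 'm) ring_scheme) \<Rightarrow> ('i \<Rightarrow> 'a) set" where
  "direct_sum_ideal I R =
    {x \<in> carrier (product_ring I R). finite {i \<in> I. x i \<noteq> \<zero>\<^bsub>R i\<^esub>}}"

lemma cring_product_ring:
  assumes R: "\<And>i. i \<in> I \<Longrightarrow> cring (R i)"
  shows "cring (product_ring I R)"
proof (rule cringI)
  note r = cring.axioms(1)[OF R]
  note a = ring.is_abelian_group[OF r]
  have neg: "\<exists>y\<in>\<Pi>\<^sub>E i\<in>I. carrier (R i). (\<lambda>i\<in>I. y i \<oplus>\<^bsub>R i\<^esub> x i) = (\<lambda>i\<in>I. \<zero>\<^bsub>R i\<^esub>)"
    if "x \<in> (\<Pi>\<^sub>E i\<in>I. carrier (R i))" for x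
    by (rule bexI[of _ "\<lambda>i\<in>I. \<ominus>\<^bsub>R i\<^esub> x i"])
       (use that a in \<open>auto simp: PiE_iff abelian_group.l_neg abelian_group.a_inv_closed
          intro!: restrict_ext\<close>)
  show "abelian_group (product_ring I R)"
    by (rule abelian_groupI; (simp add: product_ring_def neg)?)
       (use r in \<open>auto simp: PiE_iff extensional_def fun_eq_iff ring.ring_simprules\<close>)
  show "comm_monoid (product_ring I R)"
    by (rule comm_monoidI; simp add: product_ring_def)
       (use R ring.is_monoid[OF r] in \<open>auto simp: PiE_iff extensional_def fun_eq_iff
          cring.cring_simprules monoid.r_one\<close>)
  show "(x \<oplus>\<^bsub>product_ring I R\<^esub> y) \<otimes>\<^bsub>product_ring I R\<^esub> z =
      x \<otimes>\<^bsub>product_ring I R\<^esub> z \<oplus>\<^bsub>product_ring I R\<^esub> y \<otimes>\<^bsub>product_ring I R\<^esub> z"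
    if "x \<in> carrier (product_ring I R)" "y \<in> carrier (product_ring I R)"
       "z \<in> carrier (product_ring I R)" for x y z
    using that r by (auto simp: product_ring_def PiE_iff fun_eq_iff ring.ring_simprules)
qed

lemma a_inv_product_ring:
  assumes R: "\<And>i. i \<in> I \<Longrightarrow> cring (R i)" and x: "x \<in> carrier (product_ring I R)"
  shows "\<ominus>\<^bsub>product_ring I R\<^esub> x = (\<lambda>i\<in>I. \<ominus>\<^bsub>R i\<^esub> x i)"
proof -
  interpret P: cring "product_ring I R" by (rule cring_product_ring[OF R])
  have a: "abelian_group (R i)" if "i \<in> I" for i
    using R[OF that] by (intro ring.is_abelian_group cring.axioms(1))
  show ?thesis
    by (rule P.minus_equality[OF _ x])
       (use x a in \<open>auto simp: product_ring_def PiE_iff fun_eq_iff abelian_group.l_neg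
          abelian_group.a_inv_closed\<close>)
qed

lemma ideal_direct_sum_ideal:
  assumes R: "\<And>i. i \<in> I \<Longrightarrow> cring (R i)"
  shows "ideal (direct_sum_ideal I R) (product_ring I R)"
proof -
  interpret P: cring "product_ring I R" by (rule cring_product_ring[OF R])
  let ?P = "product_ring I R" and ?S = "direct_sum_ideal I R"
  let ?supp = "\<lambda>x. {i \<in> I. x i \<noteq> \<zero>\<^bsub>R i\<^esub>}"
  note r = cring.axioms(1)[OF R]
  have carr: "x i \<in> carrier (R i)" if "x \<in> carrier ?P" "i \<in> I" for x i
    using that by (auto simp: product_ring_def)
  have memI: "y \<in> ?S" if "y \<in> carrier ?P" "?supp y \<subseteq> A" "finite A" for y A
    using that by (auto simp: direct_sum_ideal_def intro: finite_subset)
  have memD: "x \<in> carrier ?P" "finite (?supp x)" if "x \<in> ?S" for x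
    using that by (auto simp: direct_sum_ideal_def)
  show ?thesis
  proof (rule idealI[OF P.ring_axioms])
    show "subgroup ?S (add_monoid ?P)"
    proof (rule group.subgroupI[OF P.a_group])
      show "?S \<subseteq> carrier (add_monoid ?P)"
        by (auto simp: direct_sum_ideal_def)
      have "\<zero>\<^bsub>?P\<^esub> \<in> ?S"
        by (rule memI[where A = "{}"]) (auto simp: product_ring_def PiE_iff ring.ring_simprules r)
      then show "?S \<noteq> {}" by blast
    next
      fix x assume "x \<in> ?S"
      note x = memD[OF this]
      have "\<ominus>\<^bsub>?P\<^esub> x \<in> ?S"
      proof (rule memI[OF P.a_inv_closed[OF x(1)] _ x(2)])
        show "?supp (\<ominus>\<^bsub>?P\<^esub> x) \<subseteq> ?supp x"
          using r by (auto simp: a_inv_product_ring[OF R x(1)] ring.ring_simprules)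
      qed
      then show "inv\<^bsub>add_monoid ?P\<^esub> x \<in> ?S" by (simp add: a_inv_def)
    next
      fix x y assume "x \<in> ?S" "y \<in> ?S"
      note x = memD[OF this(1)] and y = memD[OF this(2)]
      have "x \<oplus>\<^bsub>?P\<^esub> y \<in> ?S"
        by (rule memI[where A = "?supp x \<union> ?supp y"])
           (use x y r carr in \<open>auto simp: product_ring_def PiE_iff ring.ring_simprules\<close>)
      then show "x \<otimes>\<^bsub>add_monoid ?P\<^esub> y \<in> ?S" by simp
    qed
  next
    fix a x assume "a \<in> ?S" and x: "x \<in> carrier ?P"
    note a = memD[OF this(1)]
    show "x \<otimes>\<^bsub>?P\<^esub> a \<in> ?S"
      by (rule memI[OF P.m_closed[OF x a(1)] _ a(2)])
         (use carr[OF x] r in \<open>auto simp: product_ring_def ring.ring_simprules\<close>)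
    show "a \<otimes>\<^bsub>?P\<^esub> x \<in> ?S"
      by (rule memI[OF P.m_closed[OF a(1) x] _ a(2)])
         (use carr[OF x] r in \<open>auto simp: product_ring_def ring.ring_simprules\<close>)
  qed
qed

lemma direct_sum_coset_eq_iff:
  assumes R: "\<And>i. i \<in> I \<Longrightarrow> cring (R i)"
    and x: "x \<in> carrier (product_ring I R)" and y: "y \<in> carrier (product_ring I R)"
  shows "direct_sum_ideal I R +>\<^bsub>product_ring I R\<^esub> x = direct_sum_ideal I R +>\<^bsub>product_ring I R\<^esub> y
    \<longleftrightarrow> finite {i \<in> I. x i \<noteq> y i}"
proof -
  interpret P: ideal "direct_sum_ideal I R" "product_ring I R" by (rule ideal_direct_sum_ideal[OF R])
  let ?P = "product_ring I R"
  have "x \<ominus>\<^bsub>?P\<^esub> y \<in> carrier ?P" using x y by simp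
  then have mem: "x \<ominus>\<^bsub>?P\<^esub> y \<in> direct_sum_ideal I R
      \<longleftrightarrow> finite {i \<in> I. (x \<ominus>\<^bsub>?P\<^esub> y) i \<noteq> \<zero>\<^bsub>R i\<^esub>}"
    unfolding direct_sum_ideal_def by blast
  have eq: "(x \<ominus>\<^bsub>?P\<^esub> y) i = \<zero>\<^bsub>R i\<^esub> \<longleftrightarrow> x i = y i" if i: "i \<in> I" for i
  proof -
    interpret Ri: cring "R i" by (rule R[OF i])
    have c: "x i \<in> carrier (R i)" "y i \<in> carrier (R i)" using x y i by (auto simp: product_ring_def)
    have "(x \<ominus>\<^bsub>?P\<^esub> y) i = x i \<ominus>\<^bsub>R i\<^esub> y i"
      using i by (simp add: a_minus_def a_inv_product_ring[OF R y])
        (simp add: product_ring_def a_minus_def)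
    then show ?thesis using c by simp
  qed
  have "{i \<in> I. (x \<ominus>\<^bsub>?P\<^esub> y) i \<noteq> \<zero>\<^bsub>R i\<^esub>} = {i \<in> I. x i \<noteq> y i}"
    using eq by blast
  then have "x \<ominus>\<^bsub>?P\<^esub> y \<in> direct_sum_ideal I R \<longleftrightarrow> finite {i \<in> I. x i \<noteq> y i}"
    by (rule subst) (rule mem)
  then show ?thesis
    unfolding P.quotient_eq_iff_same_a_r_cos[OF P.ideal_axioms x y] by simp
qed


section \<open>The ring $\mathcal{A}$\<close>

abbreviation primes :: "nat set" where
  "primes \<equiv> {p. prime p}"

abbreviation ZZ_mod :: "nat \<Rightarrow> int ring" where
  "ZZ_mod p \<equiv> residue_ring (int p)"

definition ring_A :: "(nat \<Rightarrow> int) set ring" where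
  "ring_A = product_ring primes ZZ_mod Quot direct_sum_ideal primes ZZ_mod"

definition class_A :: "(nat \<Rightarrow> int) \<Rightarrow> (nat \<Rightarrow> int) set" where
  "class_A x = direct_sum_ideal primes ZZ_mod +>\<^bsub>product_ring primes ZZ_mod\<^esub> restrict x primes"

lemma cring_ZZ_mod: "p \<in> primes \<Longrightarrow> cring (ZZ_mod p)"
  using residues.cring[of "int p"] prime_gt_1_nat[of p] by (simp add: residues_def)

lemma cring_ring_A: "cring ring_A"
  unfolding ring_A_def
  by (intro ideal.quotient_is_cring ideal_direct_sum_ideal cring_product_ring cring_ZZ_mod)

lemma class_A_in_carrier:
  assumes "\<And>p. prime p \<Longrightarrow> x p \<in> carrier (ZZ_mod p)"
  shows "class_A x \<in> carrier ring_A"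
proof -
  have "restrict x primes \<in> carrier (product_ring primes ZZ_mod)"
    using assms by (auto simp: product_ring_def)
  then show ?thesis
    by (auto simp: ring_A_def class_A_def FactRing_def A_RCOSETS_defs a_r_coset_def)
qed

lemma class_A_eq_iff:
  assumes "\<And>p. prime p \<Longrightarrow> x p \<in> carrier (ZZ_mod p)"
    and "\<And>p. prime p \<Longrightarrow> y p \<in> carrier (ZZ_mod p)"
  shows "class_A x = class_A y \<longleftrightarrow> finite {p. prime p \<and> x p \<noteq> y p}"
proof -
  have "class_A x = class_A y \<longleftrightarrow> finite {p \<in> primes. restrict x primes p \<noteq> restrict y primes p}"
    unfolding class_A_def
    by (rule direct_sum_coset_eq_iff) (use assms cring_ZZ_mod in \<open>auto simp: product_ring_def\<close>)
  also have "{p \<in> primes. restrict x primes p \<noteq> restrict y primes p} = {p. prime p \<and> x p \<noteq> y p}"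
    by auto
  finally show ?thesis .
qed


section \<open>Finite multiple mixed values\<close>

text \<open>
  An index \<open>(s\<^sub>1, \<dots>, s\<^sub>d)\<close> is an \<^typ>\<open>int list\<close> with nonzero entries; list positions start at
  \<open>0\<close>, so \<open>s\<^sub>j\<close> is \<open>s ! (j - 1)\<close>.
\<close>

definition weight :: "int list \<Rightarrow> nat" where
  "weight s = (\<Sum>k\<leftarrow>s. nat \<bar>k\<bar>)"

definition mixed_tuples :: "int list \<Rightarrow> nat \<Rightarrow> nat list set" where
  "mixed_tuples s p =
    {n. length n = length s \<and> sorted_wrt (>) n \<and>
        (\<forall>j<length s. 0 < n ! j \<and> n ! j < p \<and>
           (0 < s ! j \<longrightarrow> even (n ! j)) \<and> (s ! j < 0 \<longrightarrow> odd (n ! j)))}"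

definition mixed_sum :: "int list \<Rightarrow> nat \<Rightarrow> int" where
  "mixed_sum s p =
    (\<Oplus>\<^bsub>ZZ_mod p\<^esub>n\<in>mixed_tuples s p. \<Otimes>\<^bsub>ZZ_mod p\<^esub>j\<in>{..<length s}.
       inv\<^bsub>ZZ_mod p\<^esub> (int (n ! j) [^]\<^bsub>ZZ_mod p\<^esub> nat \<bar>s ! j\<bar>))"

definition M_A :: "int list \<Rightarrow> (nat \<Rightarrow> int) set" where
  "M_A s = class_A (mixed_sum s)"

text \<open>
  The following variants are meant for indices with positive entries. In \<open>T_A\<close> and \<open>S_A\<close> the
  signs \<open>(-1)\<^bsup>d-j+1\<^esup>\<close> and \<open>(-1)\<^bsup>d-j\<^esup>\<close> are written in terms of the list position \<open>i = j - 1\<close>.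
\<close>

definition t_A :: "int list \<Rightarrow> (nat \<Rightarrow> int) set" where
  "t_A s = M_A (map uminus s)"

definition zeta2_A :: "int list \<Rightarrow> (nat \<Rightarrow> int) set" where
  "zeta2_A s = M_A s"

definition T_A :: "int list \<Rightarrow> (nat \<Rightarrow> int) set" where
  "T_A s = M_A (map (\<lambda>i. (- 1) ^ (length s - i) * s ! i) [0..<length s])"

definition S_A :: "int list \<Rightarrow> (nat \<Rightarrow> int) set" where
  "S_A s = M_A (map (\<lambda>i. (- 1) ^ (length s - Suc i) * s ! i) [0..<length s])"

definition sign_A :: "int list \<Rightarrow> (nat \<Rightarrow> int) set" where
  "sign_A s = (\<ominus>\<^bsub>ring_A\<^esub> \<one>\<^bsub>ring_A\<^esub>) [^]\<^bsub>ring_A\<^esub> weight s"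

lemma mixed_sum_in_carrier:
  assumes "prime p"
  shows "mixed_sum s p \<in> carrier (ZZ_mod p)"
proof -
  interpret residues_prime p "ZZ_mod p"
    using assms by (simp_all add: residues_prime_def)
  have unit: "int k [^]\<^bsub>ZZ_mod p\<^esub> (e::nat) \<in> Units (ZZ_mod p)" if "0 < k" "k < p" for k e
  proof (rule Units_pow_closed)
    have "coprime (int k) (int p)"
      using that assms by (metis coprime_commute coprime_int_iff nat_dvd_not_less prime_imp_coprime_nat)
    then show "int k \<in> Units (ZZ_mod p)"
      using that by (simp add: res_units_eq)
  qed
  show ?thesis
    unfolding mixed_sum_def
    by (intro finsum_closed Pi_I finprod_closed Units_inv_closed unit) (auto simp: mixed_tuples_def)
qed

lemma M_A_in_carrier: "M_A s \<in> carrier ring_A"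
  unfolding M_A_def by (intro class_A_in_carrier mixed_sum_in_carrier)

end

theory Submission
  imports Defs
begin

text \<open>
  For an odd prime \<open>p\<close> the map \<open>(n\<^sub>1, \<dots>, n\<^sub>d) \<mapsto> (p - n\<^sub>d, \<dots>, p - n\<^sub>1)\<close> preserves
  strictly decreasing tuples in \<open>{1..<p}\<close> and flips the parity of every entry, while
  \<open>1 / (p - n)\<^sup>k \<equiv> (-1)\<^sup>k / n\<^sup>k\<close> modulo \<open>p\<close>. Hence the two sides agree at every prime other than \<open>2\<close>.
  The remaining identities only require comparing the sign patterns.
\<close>

section \<open>Signs and inverse powers in a ring\<close>

lemma (in ring) minus_one_pow:
  "(\<ominus> \<one>) [^] (n::nat) = (if even n then \<one> else \<ominus> \<one>)"
  by (induction n) (auto simp: l_minus)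

lemma (in ring) minus_pow:
  assumes "x \<in> carrier R"
  shows "(\<ominus> x) [^] (n::nat) = (\<ominus> \<one>) [^] n \<otimes> x [^] n"
proof -
  have "(\<ominus> x) [^] n = (if even n then x [^] n else \<ominus> (x [^] n))"
    using assms by (induction n) (auto simp: l_minus r_minus)
  then show ?thesis
    using assms by (simp add: minus_one_pow l_minus)
qed

text \<open>A power of \<open>\<ominus> \<one>\<close> squares to \<open>\<one>\<close> and so is
  its own inverse; multiplying out then confirms the right-hand side as the inverse.\<close>

lemma (in cring) inv_minus_pow:
  assumes x: "x \<in> Units R"
  shows "inv ((\<ominus> x) [^] (n::nat)) = (\<ominus> \<one>) [^] n \<otimes> inv (x [^] n)"
proof (rule comm_inv_char)
  have u: "x [^] n \<in> Units R"
    by (rule Units_pow_closed[OF x])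
  have xc: "x \<in> carrier R" 
    using x by (rule Units_closed)
  have sq: "(\<ominus> \<one>) [^] n \<otimes> (\<ominus> \<one>) [^] n = \<one>"
    by (simp add: minus_one_pow l_minus)
  have "(\<ominus> x) [^] n \<otimes> ((\<ominus> \<one>) [^] n \<otimes> inv (x [^] n))
      = ((\<ominus> \<one>) [^] n \<otimes> (\<ominus> \<one>) [^] n) \<otimes> (x [^] n \<otimes> inv (x [^] n))"
    \<comment> \<open>The instance \<open>x = \<one>\<close> of \<open>minus_pow\<close> reproduces
      its own left side, so the sign is split off before the closure of \<open>\<one>\<close> comes
      in; only afterwards are the factors regrouped.\<close>
    using u xc by (simp only: minus_pow) (simp only: m_ac Units_inv_closed Units_closed
      nat_pow_closed a_inv_closed one_closed m_closed)
  then show "(\<ominus> x) [^] n \<otimes> ((\<ominus> \<one>) [^] n \<otimes> inv (x [^] n)) = \<one>"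
    using u sq by simp
qed (use x in \<open>auto intro: Units_pow_closed\<close>)

text \<open>Serves to collect the signs of the single factors into one sign whose exponent is the
  weight.\<close>

lemma (in comm_monoid) finprod_pow_nat:
  assumes "finite A" "x \<in> carrier G"
  shows "(\<Otimes>i\<in>A. x [^] (f i::nat)) = x [^] (\<Sum>i\<in>A. f i)"
  using assms by (induction A rule: finite_induct) (auto simp: nat_pow_mult)

lemma weight_eq_sum_nth: "weight s = (\<Sum>j<length s. nat \<bar>s ! j\<bar>)"
  by (simp add: weight_def sum_list_sum_nth atLeast0LessThan)

section \<open>Tuples below \<open>p\<close> and their reflection\<close>

lemma finite_mixed_tuples: "finite (mixed_tuples s p)"
proof (rule finite_subset)
  show "mixed_tuples s p \<subseteq> {n. set n \<subseteq> {..<p} \<and> length n = length s}"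
    by (auto simp: mixed_tuples_def in_set_conv_nth)
qed (simp add: finite_lists_length_eq)

text \<open>Reversing the list compensates for \<open>k \<mapsto> p - k\<close> being antitone. The
  subtraction is the truncated one on \<open>nat\<close>, which is exact on the tuples considered
  because their entries lie below \<open>p\<close>.\<close>

definition reflect :: "nat \<Rightarrow> nat list \<Rightarrow> nat list" where
  "reflect p n = rev (map (\<lambda>k. p - k) n)"

lemma length_reflect [simp]: "length (reflect p n) = length n"
  by (simp add: reflect_def)

lemma reflect_nth: "j < length n \<Longrightarrow> reflect p n ! j = p - n ! (length n - Suc j)"
  by (simp add: reflect_def rev_nth)

lemma reflect_reflect:
  assumes "n \<in> mixed_tuples s p"
  shows "reflect p (reflect p n) = n"
  using assms by (intro nth_equalityI) (auto simp: reflect_nth mixed_tuples_def less_imp_le)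

lemma reflect_in_mixed_tuples:
  assumes p: "odd p" and n: "n \<in> mixed_tuples s p"
  shows "reflect p n \<in> mixed_tuples (rev (map uminus s)) p"
proof -
  have len: "length n = length s" and dec: "sorted_wrt (>) n"
    using n by (auto simp: mixed_tuples_def)
  have bound: "0 < n ! j \<and> n ! j < p"
    and parity: "(0 < s ! j \<longrightarrow> even (n ! j)) \<and> (s ! j < 0 \<longrightarrow> odd (n ! j))"
    if "j < length s" for j
    using n that by (auto simp: mixed_tuples_def)
  have "sorted_wrt (>) (reflect p n)"
    unfolding sorted_wrt_iff_nth_less
  proof (intro allI impI)
    fix i j assume ij: "i < j" "j < length (reflect p n)"
    then have "n ! (length n - Suc i) < n ! (length n - Suc j)"
      using dec by (simp add: sorted_wrt_iff_nth_less)
    \<comment> \<open>This bound keeps the truncated subtraction strictly antitone here.\<close>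
    moreover have "n ! (length n - Suc j) < p"
      using ij len bound by simp
    ultimately show "reflect p n ! i > reflect p n ! j"
      using ij by (simp add: reflect_nth)
  qed
  moreover have "0 < reflect p n ! j \<and> reflect p n ! j < p \<and>
      (0 < rev (map uminus s) ! j \<longrightarrow> even (reflect p n ! j)) \<and>
      (rev (map uminus s) ! j < 0 \<longrightarrow> odd (reflect p n ! j))" if j: "j < length s" for j
  proof -
    let ?i = "length s - Suc j"
    have i: "?i < length s" using j by simp
    have "odd (p - n ! ?i) \<longleftrightarrow> even (n ! ?i)"
      using p bound[OF i] by (simp add: even_diff_nat)
    then show ?thesis
      using bound[OF i] parity[OF i] j len by (auto simp: reflect_nth rev_nth)
  qed
  ultimately show ?thesis
    using len by (simp add: mixed_tuples_def)
qed

text \<open>The reflection is its own inverse, and both inclusions are instances of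
  \<open>reflect_in_mixed_tuples\<close>, since reversing and negating an index are commuting
  involutions.\<close>

lemma bij_betw_reflect:
  assumes "odd p"
  shows "bij_betw (reflect p) (mixed_tuples (map uminus s) p) (mixed_tuples (rev s) p)"
proof (rule bij_betw_byWitness[where f' = "reflect p"])
  have eq: "rev (map uminus (map uminus s)) = rev s" "rev (map uminus (rev s)) = map uminus s"
    by (simp_all add: comp_def rev_map)
  show "reflect p ` mixed_tuples (map uminus s) p \<subseteq> mixed_tuples (rev s) p"
    using reflect_in_mixed_tuples[OF assms, of _ "map uminus s"] eq by auto
  show "reflect p ` mixed_tuples (rev s) p \<subseteq> mixed_tuples (map uminus s) p"
    using reflect_in_mixed_tuples[OF assms, of _ "rev s"] eq by auto
qed (simp_all add: reflect_reflect)

section \<open>The reversal identity at an odd prime\<close>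

text \<open>After the sum is reindexed by \<open>reflect p\<close>, every summand acquires the same
  sign, which depends on \<open>s\<close> but not on the tuple and therefore factors out.\<close>

lemma mixed_sum_rev:
  assumes p: "prime p" "odd p"
  shows "mixed_sum (rev s) p =
    (\<ominus>\<^bsub>ZZ_mod p\<^esub> \<one>\<^bsub>ZZ_mod p\<^esub>) [^]\<^bsub>ZZ_mod p\<^esub> weight s \<otimes>\<^bsub>ZZ_mod p\<^esub>
      mixed_sum (map uminus s) p"
proof -
  interpret residues_prime p "ZZ_mod p"
    using p by (simp_all add: residues_prime_def)
  \<comment> \<open>The simp rule \<open>pow_nat\<close>, disabled below, would turn the exponents \<open>nat \<bar>s ! j\<bar>\<close> into integer ones.\<close>
  let ?R = "ZZ_mod p" and ?d = "length s"
  let ?e = "\<lambda>j. nat \<bar>s ! j\<bar>"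
  let ?sgn = "\<lambda>e::nat. (\<ominus>\<^bsub>?R\<^esub> \<one>\<^bsub>?R\<^esub>) [^]\<^bsub>?R\<^esub> e"
  let ?term = "\<lambda>s n. \<Otimes>\<^bsub>?R\<^esub>j\<in>{..<length s}. inv\<^bsub>?R\<^esub> (int (n ! j) [^]\<^bsub>?R\<^esub> nat \<bar>s ! j\<bar>)"
  have unit: "int k \<in> Units ?R" if "0 < k" "k < p" for k
  proof -
    have "coprime (int k) (int p)"
      using that p by (metis coprime_commute coprime_int_iff nat_dvd_not_less prime_imp_coprime_nat)
    then show ?thesis
      using that by (simp add: res_units_eq)
  qed
  \<comment> \<open>Negation in \<open>?R\<close> yields the representative in
    \<open>{0..<p}\<close>, so this is an equality of integers and not just a congruence.\<close>
  have neg: "int (p - k) = \<ominus>\<^bsub>?R\<^esub> int k" if "0 < k" "k < p" for k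
    using that by (simp add: res_neg_eq zmod_zminus1_eq_if of_nat_diff)
  have bound: "0 < n ! j" "n ! j < p" if "n \<in> mixed_tuples s p" "j < length s" for s n j
    using that by (auto simp: mixed_tuples_def)
  have inv_closed: "inv\<^bsub>?R\<^esub> (int (n ! j) [^]\<^bsub>?R\<^esub> (e::nat)) \<in> carrier ?R"
    if "n \<in> mixed_tuples s p" "j < length s" for s n j e
    by (intro Units_inv_closed Units_pow_closed unit bound[OF that])
  have closed: "?term s n \<in> carrier ?R" if "n \<in> mixed_tuples s p" for s n
    by (intro finprod_closed Pi_I inv_closed[OF that]) simp
  have reflect_term: "?term (rev s) (reflect p n) = ?sgn (weight s) \<otimes>\<^bsub>?R\<^esub> ?term (map uminus s) n"
    if n: "n \<in> mixed_tuples (map uminus s) p" for n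
  proof -
    have len: "length n = ?d"
      using n by (simp add: mixed_tuples_def)
    have n': "reflect p n \<in> mixed_tuples (rev s) p"
      using bij_betw_reflect[OF p(2)] n by (auto simp: bij_betw_def)
    let ?f = "\<lambda>j. inv\<^bsub>?R\<^esub> (int (reflect p n ! j) [^]\<^bsub>?R\<^esub> nat \<bar>rev s ! j\<bar>)"
    let ?g = "\<lambda>j. inv\<^bsub>?R\<^esub> (int (n ! j) [^]\<^bsub>?R\<^esub> ?e j)"
    have g: "?g \<in> {..<?d} \<rightarrow> carrier ?R"
      by (intro Pi_I inv_closed[OF n]) simp
    have f: "?f \<in> {..<?d} \<rightarrow> carrier ?R"
      by (intro Pi_I inv_closed[OF n']) simp
    \<comment> \<open>Entry \<open>?d - Suc j\<close> of the reflected tuple is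
      \<open>p - n ! j\<close>, and \<open>rev s\<close> has \<open>s ! j\<close> there; this
      reindexing lines up the factors of both products.\<close>
    have bij: "bij_betw (\<lambda>j. ?d - Suc j) {..<?d} {..<?d}"
      by (rule bij_betw_byWitness[where f' = "\<lambda>j. ?d - Suc j"]) auto
    have "?term (rev s) (reflect p n) = finprod ?R ?f ((\<lambda>j. ?d - Suc j) ` {..<?d})"
      using bij by (simp add: bij_betw_def)
    also have "\<dots> = (\<Otimes>\<^bsub>?R\<^esub>j\<in>{..<?d}. ?f (?d - Suc j))"
      by (rule finprod_reindex) (use bij f in \<open>simp_all only: bij_betw_def\<close>)
    also have "\<dots> = (\<Otimes>\<^bsub>?R\<^esub>j\<in>{..<?d}. ?sgn (?e j) \<otimes>\<^bsub>?R\<^esub> ?g j)"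
    proof (rule finprod_cong')
      fix j assume "j \<in> {..<?d}"
      then have j: "j < ?d" by simp
      have b: "0 < n ! j" "n ! j < p"
        using bound[OF n, of j] j by auto
      show "?f (?d - Suc j) = ?sgn (?e j) \<otimes>\<^bsub>?R\<^esub> ?g j"
        using j len inv_minus_pow[OF unit[OF b]] by (simp add: reflect_nth rev_nth neg[OF b] del: pow_nat)
    qed (use g in \<open>auto simp del: pow_nat\<close>)
    also have "\<dots> = (\<Otimes>\<^bsub>?R\<^esub>j\<in>{..<?d}. ?sgn (?e j)) \<otimes>\<^bsub>?R\<^esub> finprod ?R ?g {..<?d}"
      by (rule finprod_multf) (use g in \<open>auto simp del: pow_nat\<close>)
    also have "(\<Otimes>\<^bsub>?R\<^esub>j\<in>{..<?d}. ?sgn (?e j)) = ?sgn (weight s)"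
      unfolding weight_eq_sum_nth by (rule finprod_pow_nat) auto
    \<comment> \<open>The exponents are absolute values, so negating the index leaves the factors
      unchanged.\<close>
    also have "finprod ?R ?g {..<?d} = ?term (map uminus s) n"
      by (rule finprod_cong') (use inv_closed[OF n] in \<open>auto simp del: pow_nat\<close>)
    finally show ?thesis .
  qed
  have bij: "inj_on (reflect p) (mixed_tuples (map uminus s) p)"
    "mixed_tuples (rev s) p = reflect p ` mixed_tuples (map uminus s) p"
    using bij_betw_reflect[OF p(2), of s] by (auto simp: bij_betw_def)
  have "mixed_sum (rev s) p =
      (\<Oplus>\<^bsub>?R\<^esub>n\<in>mixed_tuples (map uminus s) p. ?term (rev s) (reflect p n))"
    unfolding mixed_sum_def bij(2)
    by (rule finsum_reindex[OF _ bij(1)]) (use closed[of _ "rev s"] bij(2) in auto)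
  also have "\<dots> = (\<Oplus>\<^bsub>?R\<^esub>n\<in>mixed_tuples (map uminus s) p.
      ?sgn (weight s) \<otimes>\<^bsub>?R\<^esub> ?term (map uminus s) n)"
    by (intro finsum_cong' refl Pi_I m_closed nat_pow_closed a_inv_closed one_closed
        closed reflect_term)
  also have "\<dots> = ?sgn (weight s) \<otimes>\<^bsub>?R\<^esub> mixed_sum (map uminus s) p"
    unfolding mixed_sum_def
    by (intro finsum_rdistr[symmetric] finite_mixed_tuples Pi_I nat_pow_closed a_inv_closed
        one_closed closed)
  finally show ?thesis .
qed

section \<open>From residues to classes in \<open>ring_A\<close>\<close>

text \<open>The coset map is a ring homomorphism, and negation in the product ring is
  componentwise.\<close>

lemma a_inv_class_A:
  assumes "\<And>p. prime p \<Longrightarrow> x p \<in> carrier (ZZ_mod p)"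
  shows "\<ominus>\<^bsub>ring_A\<^esub> class_A x = class_A (\<lambda>p. \<ominus>\<^bsub>ZZ_mod p\<^esub> x p)"
proof -
  let ?P = "product_ring primes ZZ_mod" and ?I = "direct_sum_ideal primes ZZ_mod"
  interpret I: ideal ?I ?P
    by (rule ideal_direct_sum_ideal[OF cring_ZZ_mod])
  interpret h: ring_hom_ring ?P "?P Quot ?I" "(+>\<^bsub>?P\<^esub>) ?I"
    by (rule I.rcos_ring_hom_ring)
  have x: "restrict x primes \<in> carrier ?P"
    using assms by (auto simp: product_ring_def)
  have "restrict (\<lambda>p. \<ominus>\<^bsub>ZZ_mod p\<^esub> x p) primes = \<ominus>\<^bsub>?P\<^esub> restrict x primes"
    by (subst a_inv_product_ring[OF cring_ZZ_mod x]) auto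
  then show ?thesis
    unfolding class_A_def ring_A_def using x by simp
qed

text \<open>On both sides the sign is \<open>\<one>\<close> or \<open>\<ominus> \<one>\<close>
  according to the parity of the weight, so compatibility of classes with negation suffices.\<close>

lemma sign_A_mult_class_A:
  assumes "\<And>p. prime p \<Longrightarrow> x p \<in> carrier (ZZ_mod p)"
  shows "sign_A s \<otimes>\<^bsub>ring_A\<^esub> class_A x =
    class_A (\<lambda>p. (\<ominus>\<^bsub>ZZ_mod p\<^esub> \<one>\<^bsub>ZZ_mod p\<^esub>) [^]\<^bsub>ZZ_mod p\<^esub> weight s \<otimes>\<^bsub>ZZ_mod p\<^esub> x p)"
    (is "_ = class_A ?y")
proof -
  interpret A: cring ring_A by (rule cring_ring_A)
  have c: "class_A x \<in> carrier ring_A"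
    using assms by (rule class_A_in_carrier)
  have y: "?y p = (if even (weight s) then x p else \<ominus>\<^bsub>ZZ_mod p\<^esub> x p)" if "prime p" for p
  proof -
    interpret Z: cring "ZZ_mod p" using that by (intro cring_ZZ_mod) simp
    show ?thesis
      using assms[OF that] by (simp add: Z.minus_one_pow Z.l_minus)
  qed
  \<comment> \<open>A class sees only the values at primes, where \<open>y\<close> applies.\<close>
  then have "class_A ?y = class_A (\<lambda>p. if even (weight s) then x p else \<ominus>\<^bsub>ZZ_mod p\<^esub> x p)"
    unfolding class_A_def by (intro arg_cong[where f = "\<lambda>z. _ +>\<^bsub>_\<^esub> z"]) auto
  also have "\<dots> = sign_A s \<otimes>\<^bsub>ring_A\<^esub> class_A x"
    using c by (cases "even (weight s)")
      (simp_all add: sign_A_def A.minus_one_pow A.l_minus a_inv_class_A[OF assms])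
  finally show ?thesis by simp
qed

lemma M_A_rev: "M_A (rev s) = sign_A s \<otimes>\<^bsub>ring_A\<^esub> M_A (map uminus s)"
proof -
  let ?y = "\<lambda>p. (\<ominus>\<^bsub>ZZ_mod p\<^esub> \<one>\<^bsub>ZZ_mod p\<^esub>) [^]\<^bsub>ZZ_mod p\<^esub> weight s \<otimes>\<^bsub>ZZ_mod p\<^esub>
    mixed_sum (map uminus s) p"
  have "?y p \<in> carrier (ZZ_mod p)" if "prime p" for p
  proof -
    interpret Z: cring "ZZ_mod p" using that by (intro cring_ZZ_mod) simp
    show ?thesis using mixed_sum_in_carrier[OF that] by simp
  qed
  then have "class_A (mixed_sum (rev s)) = class_A ?y \<longleftrightarrow>
      finite {p. prime p \<and> mixed_sum (rev s) p \<noteq> ?y p}"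
    by (intro class_A_eq_iff mixed_sum_in_carrier)
  \<comment> \<open>An even prime is divisible by the prime 2 and hence equal to it.\<close>
  moreover have "{p. prime p \<and> mixed_sum (rev s) p \<noteq> ?y p} \<subseteq> {2}"
    using mixed_sum_rev by (auto dest: primes_dvd_imp_eq[OF two_is_prime_nat])
  then have "finite {p. prime p \<and> mixed_sum (rev s) p \<noteq> ?y p}"
    by (rule finite_subset) simp
  ultimately show ?thesis
    unfolding M_A_def by (simp add: sign_A_mult_class_A mixed_sum_in_carrier)
qed

section \<open>Sign patterns of the special values\<close>

lemma sign_A_cong:
  assumes "length u = length s" "\<And>i. i < length s \<Longrightarrow> \<bar>u ! i\<bar> = \<bar>s ! i\<bar>"
  shows "sign_A u = sign_A s"
  using assms by (simp add: sign_A_def weight_eq_sum_nth)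

text \<open>Here \<open>u\<close> is \<open>s\<close> with signs attached to prescribe parities.
  This changes no absolute value, so the factor \<open>sign_A s\<close> remains, and each special
  case reduces to comparing two lists.\<close>

lemma M_A_rev_cong:
  assumes "length u = length s" "\<And>i. i < length s \<Longrightarrow> \<bar>u ! i\<bar> = \<bar>s ! i\<bar>"
    and "v = rev u" "w = map uminus u"
  shows "M_A v = sign_A s \<otimes>\<^bsub>ring_A\<^esub> M_A w"
  using M_A_rev[of u] sign_A_cong[OF assms(1,2)] assms(3,4) by simp

lemma T_A_rev:
  "T_A (rev s) = sign_A s \<otimes>\<^bsub>ring_A\<^esub> (if even (length s) then T_A s else S_A s)"
proof -
  \<comment> \<open>Chosen so that \<open>rev ?u\<close> is the pattern of
    \<open>T_A (rev s)\<close>. Negating \<open>?u\<close> gives the signs \<open>(- 1) ^ i\<close>,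
    which equal \<open>(- 1) ^ (length s - i)\<close> for even length and
    \<open>(- 1) ^ (length s - Suc i)\<close> for odd length.\<close>
  let ?u = "map (\<lambda>i. (- 1) ^ Suc i * s ! i) [0..<length s]"
  have "M_A (map (\<lambda>i. (- 1) ^ (length (rev s) - i) * rev s ! i) [0..<length (rev s)]) =
    sign_A s \<otimes>\<^bsub>ring_A\<^esub> M_A (if even (length s)
      then map (\<lambda>i. (- 1) ^ (length s - i) * s ! i) [0..<length s]
      else map (\<lambda>i. (- 1) ^ (length s - Suc i) * s ! i) [0..<length s])"
    by (rule M_A_rev_cong[where u = ?u])
       (auto simp: abs_mult rev_nth minus_one_power_iff Suc_diff_Suc intro!: nth_equalityI)
  then show ?thesis
    by (simp add: T_A_def S_A_def split: if_splits)
qed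

lemma S_A_rev:
  "S_A (rev s) = sign_A s \<otimes>\<^bsub>ring_A\<^esub> (if even (length s) then S_A s else T_A s)"
proof -
  \<comment> \<open>Now \<open>rev ?u\<close> is the pattern of \<open>S_A (rev s)\<close>, and the
    negated signs \<open>(- 1) ^ Suc i\<close> match \<open>S_A s\<close> for even length and
    \<open>T_A s\<close> for odd length.\<close>
  let ?u = "map (\<lambda>i. (- 1) ^ i * s ! i) [0..<length s]"
  have "M_A (map (\<lambda>i. (- 1) ^ (length (rev s) - Suc i) * rev s ! i) [0..<length (rev s)]) =
    sign_A s \<otimes>\<^bsub>ring_A\<^esub> M_A (if even (length s)
      then map (\<lambda>i. (- 1) ^ (length s - Suc i) * s ! i) [0..<length s]
      else map (\<lambda>i. (- 1) ^ (length s - i) * s ! i) [0..<length s])"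
    by (rule M_A_rev_cong[where u = ?u])
       (auto simp: abs_mult rev_nth minus_one_power_iff Suc_diff_Suc intro!: nth_equalityI)
  then show ?thesis
    by (simp add: T_A_def S_A_def split: if_splits)
qed

text \<open>With \<open>u\<close> the negated index, the second negation restores \<open>s\<close>
  itself, turning all odd entries into even ones.\<close>

lemma t_A_rev: "t_A (rev s) = sign_A s \<otimes>\<^bsub>ring_A\<^esub> zeta2_A s"
  unfolding t_A_def zeta2_A_def
  by (rule M_A_rev_cong[where u = "map uminus s"]) (auto simp: rev_map comp_def)

theorem proposition2p6:
  fixes d :: nat and s :: "int list"
  assumes "d \<ge> 1" and "length s = d"
  shows "(0 \<notin> set s \<longrightarrow> M_A (rev s) = sign_A s \<otimes>\<^bsub>ring_A\<^esub> M_A (map uminus s)) \<and>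
    ((\<forall>k\<in>set s. 0 < k) \<longrightarrow>
      t_A (rev s) = sign_A s \<otimes>\<^bsub>ring_A\<^esub> zeta2_A s \<and>
      (even d \<longrightarrow> T_A (rev s) = sign_A s \<otimes>\<^bsub>ring_A\<^esub> T_A s \<and>
                  S_A (rev s) = sign_A s \<otimes>\<^bsub>ring_A\<^esub> S_A s) \<and>
      (odd d \<longrightarrow> T_A (rev s) = sign_A s \<otimes>\<^bsub>ring_A\<^esub> S_A s \<and>
                 S_A (rev s) = sign_A s \<otimes>\<^bsub>ring_A\<^esub> T_A s))"
  using assms M_A_rev t_A_rev T_A_rev S_A_rev by simp

end
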